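(* Let $n_s\ge 1$ be an integer, let $\Omega_\zeta:=\{0,1\}^{n_s}$ and $\Omega_\theta:=[0,1]^{n_s}$, and consider the two functions $\mathcal{J}:\Omega_\zeta\to\mathbb{R}$, $\mathcal{J}(\zeta):=\Psi(\zeta)+\alpha\,\Phi(\zeta)$, and $\Upsilon:\Omega_\theta\to\mathbb{R}$, $$\Upsilon(\theta):=\mathbb{E}_{\zeta\sim\mathbb{P}(\zeta|\theta)}[\mathcal{J}(\zeta)]=\sum_{\zeta\in\Omega_\zeta}\mathcal{J}(\zeta)\,\mathbb{P}(\zeta|\theta),$$ where $\zeta\in\Omega_\zeta$ is a random vector following the multivariate Bernoulli distribution $\mathbb{P}(\cdot|\theta)$ with parameter $\theta\in\Omega_\theta$. Let $C:=\{c\in\mathbb{R}\,:\,c=\mathcal{J}(\zeta),\ \zeta\in\Omega_\zeta\}$ be the set of objective values corresponding to all possible designs $\zeta\in\Omega_\zeta$. Let $\zeta^{\mathrm{opt}}$ be a minimizer of $\mathcal{J}$ over $\Omega_\zeta$ and $\theta^{\mathrm{opt}}$ a minimizer of $\Upsilon$ over $\Omega_\theta$. Then: (a) $\Omega_\theta$ is the convex hull of $\Omega_\zeta$ in $\mathbb{R}^{n_s}$. (b) The values of $\Upsilon$ form the convex hull of $C$ in $\mathbb{R}$, denoted by $\mathrm{conv}(C)$, with the points $c\in C$ being the extreme points of $\mathrm{conv}(C)$; that is, $\mathrm{conv}(C)=\{\Upsilon(\theta)\,:\,\theta\in\Omega_\theta\}$. (c) $\Upsilon(x)=\mathcal{J}(x)$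 for all $x\in\Omega_\zeta$. (d) For any $\theta\in\Omega_\theta$, it holds that $\min C\le\Upsilon(\theta)\le\max C$; moreover, $\Upsilon(\theta^{\mathrm{opt}})=\min C=\mathcal{J}(\zeta^{\mathrm{opt}})$.
   Context: The multivariate Bernoulli distribution with parameter $\theta=(\theta_1,\dots,\theta_{n_s})\in[0,1]^{n_s}$ is the law of $\zeta=(\zeta_1,\dots,\zeta_{n_s})\in\{0,1\}^{n_s}$ with independent components, $\zeta_i=1$ with probability $\theta_i$ and $\zeta_i=0$ with probability $1-\theta_i$. Its probability mass function is $$\mathbb{P}(\zeta|\theta)=\prod_{i=1}^{n_s}\theta_i^{\zeta_i}(1-\theta_i)^{1-\zeta_i}=\prod_{i=1}^{n_s}\big(\theta_i\zeta_i+(1-\theta_i)(1-\zeta_i)\big)$$ (with $0^0=1$). The function $\mathcal{J}=\Psi+\alpha\Phi$ is the objective of a binary optimal experimental design problem: $\zeta\in\{0,1\}^{n_s}$ is a binary design (component $\zeta_i=1$ means that the $i$-th candidate sensor is active), $\Psi$ is a real-valued optimality criterion of choice, $\Phi$ is a real-valued function, possibly discontinuous, promoting regularization or sparsity of the design, and $\alpha$ is a user-defined regularization parameter.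
   Formalization: In (b), the claim that the points of C are the extreme points of conv(C) fails when J takes three or more values (e.g. 0, 1, 2); it is replaced by: every extreme point of conv(C) lies in C, and the extreme points are exactly min C and max C. *)

theory Defs
  imports "HOL-Probability.Probability"
begin

definition designs :: "(real ^ 'n) set" where
  "designs = {\<zeta>. \<forall>i. \<zeta> $ i \<in> {0, 1}}"

definition params :: "(real ^ 'n) set" where
  "params = {\<theta>. \<forall>i. \<theta> $ i \<in> {0..1}}"

(* The law of a vector with independent Bernoulli components. Only meaningful for \<theta> in params,
   since bernoulli_pmf clips its parameter to the unit interval. *)
definition mv_bernoulli :: "real ^ 'n \<Rightarrow> (real ^ 'n) pmf" where
  "mv_bernoulli \<theta> =
     map_pmf (\<lambda>b. \<chi> i. of_bool (b i)) (Pi_pmf UNIV undefined (\<lambda>i. bernoulli_pmf (\<theta> $ i)))"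

lemma finite_designs: "finite (designs :: (real ^ 'n) set)"
proof -
  have "(designs :: (real ^ 'n) set) \<subseteq> (\<lambda>f. \<chi> i. f i) ` (UNIV \<rightarrow>\<^sub>E {0, 1})"
  proof
    fix z :: "real ^ 'n" assume "z \<in> designs"
    then have "($) z \<in> UNIV \<rightarrow>\<^sub>E {0, 1}" "z = (\<chi> i. z $ i)"
      by (auto simp: designs_def vec_eq_iff)
    then show "z \<in> (\<lambda>f. \<chi> i. f i) ` (UNIV \<rightarrow>\<^sub>E {0, 1})" by blast
  qed
  then show ?thesis by (rule finite_subset) (intro finite_imageI finite_PiE; simp)
qed

lemma set_pmf_mv_bernoulli: "set_pmf (mv_bernoulli \<theta>) \<subseteq> designs"
  by (auto simp: mv_bernoulli_def designs_def)

lemma pmf_mv_bernoulli: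
  fixes \<theta> \<zeta> :: "real ^ 'n"
  assumes "\<theta> \<in> params" "\<zeta> \<in> designs"
  shows "pmf (mv_bernoulli \<theta>) \<zeta> = (\<Prod>i\<in>UNIV. \<theta> $ i * \<zeta> $ i + (1 - \<theta> $ i) * (1 - \<zeta> $ i))"
proof -
  let ?g = "\<lambda>b. \<chi> i. of_bool (b i) :: real ^ 'n"
  let ?b = "\<lambda>i. \<zeta> $ i = 1"
  have inj: "inj ?g" by (auto simp: inj_def vec_eq_iff fun_eq_iff of_bool_eq_iff)
  have z: "\<zeta> $ i = of_bool (?b i)" for i using assms(2) by (auto simp: designs_def)
  have eq: "\<zeta> = ?g ?b" using z by (simp add: vec_eq_iff)
  have "pmf (mv_bernoulli \<theta>) \<zeta> = pmf (Pi_pmf UNIV undefined (\<lambda>i. bernoulli_pmf (\<theta> $ i))) ?b"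
    unfolding mv_bernoulli_def by (subst (1) eq) (rule pmf_map_inj'[OF inj])
  also have "\<dots> = (\<Prod>i\<in>UNIV. pmf (bernoulli_pmf (\<theta> $ i)) (?b i))"
    by (subst pmf_Pi) auto
  also have "\<dots> = (\<Prod>i\<in>UNIV. \<theta> $ i * \<zeta> $ i + (1 - \<theta> $ i) * (1 - \<zeta> $ i))"
  proof (rule prod.cong[OF refl])
    fix i
    have "0 \<le> \<theta> $ i" "\<theta> $ i \<le> 1" using assms(1) by (auto simp: params_def)
    moreover have "\<zeta> $ i = 0 \<or> \<zeta> $ i = 1" using assms(2) by (auto simp: designs_def)
    ultimately show "pmf (bernoulli_pmf (\<theta> $ i)) (?b i) =
        \<theta> $ i * \<zeta> $ i + (1 - \<theta> $ i) * (1 - \<zeta> $ i)" by auto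
  qed
  finally show ?thesis .
qed

lemma expectation_mv_bernoulli:
  fixes J :: "real ^ 'n \<Rightarrow> real"
  shows "measure_pmf.expectation (mv_bernoulli \<theta>) J = (\<Sum>\<zeta>\<in>designs. J \<zeta> * pmf (mv_bernoulli \<theta>) \<zeta>)"
  using set_pmf_mv_bernoulli[of \<theta>]
  by (intro integral_measure_pmf_real finite_designs) auto

end

theory Submission
  imports Defs
begin

text \<open>
  Taking the expectation extends \<open>J\<close> from the vertices of the unit cube to the whole cube. Three
  properties of this extension give everything. At a vertex the components of the Bernoulli vector
  are deterministic, so the law is a point mass and the extension agrees with \<open>J\<close>. At any other
  parameter the value is a weighted mean of the numbers in \<open>C\<close>, hence lies in \<open>convex hull C\<close>, which
  for a finite set of reals is the interval from \<open>Min C\<close> to \<open>Max C\<close>. Finally the probability mass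
  function is polynomial in the parameter, so the extension is continuous on the cube; the
  cube is connected, and the end points \<open>Min C\<close> and \<open>Max C\<close> are attained at vertices, so by
  the intermediate value theorem every number between them is attained as well.

  The extreme points of the hull are the two end points of that interval. The lower one is both
  the least value of \<open>J\<close> on the vertices and the least value of the extension on the cube, which
  is why the relaxed problem and the binary problem have the same optimal value.
\<close>

lemma params_eq_cbox: "(params :: (real ^ 'n) set) = cbox 0 One"
proof -
  have "(One :: real ^ 'n) $ i = 1" for i
    using inner_sum_Basis[of "axis i 1 :: real ^ 'n"] by (simp add: inner_axis axis_in_Basis_iff)
  then show ?thesis by (auto simp: params_def mem_box_cart)
qed

lemma designs_eq_Basis: "(designs :: (real ^ 'n) set) = {x. \<forall>i\<in>Basis. x \<bullet> i = 0 \<or> x \<bullet> i = 1}"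
  by (auto simp: designs_def Basis_vec_def inner_axis)

lemma params_eq_convex_hull_designs: "(params :: (real ^ 'n) set) = convex hull designs"
  by (simp only: params_eq_cbox designs_eq_Basis unit_interval_convex_hull)

lemma designs_subset_params: "designs \<subseteq> (params :: (real ^ 'n) set)"
  by (simp add: params_eq_convex_hull_designs hull_subset)

lemma designs_nonempty: "(designs :: (real ^ 'n) set) \<noteq> {}"
proof -
  have "(0 :: real ^ 'n) \<in> designs" by (simp add: designs_def)
  then show ?thesis by blast
qed

lemma convex_hull_finite_real:
  fixes S :: "real set"
  assumes "finite S" "S \<noteq> {}"
  shows "convex hull S = {Min S..Max S}"
proof
  show "convex hull S \<subseteq> {Min S..Max S}"
    using assms by (intro hull_minimal) auto
  have "closed_segment (Min S) (Max S) \<subseteq> convex hull S"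
    using assms by (intro closed_segment_subset convex_convex_hull hull_inc Min_in Max_in)
  then show "{Min S..Max S} \<subseteq> convex hull S"
    using assms by (simp add: closed_segment_eq_real_ivl)
qed

lemma extreme_points_convex_hull_finite_real:
  fixes S :: "real set"
  assumes "finite S" "S \<noteq> {}"
  shows "{c. c extreme_point_of (convex hull S)} = {Min S, Max S}"
proof -
  have "convex hull S = closed_segment (Min S) (Max S)"
    using assms by (simp add: convex_hull_finite_real closed_segment_eq_real_ivl)
  then show ?thesis by (auto simp: extreme_point_of_segment)
qed

text \<open>Bernoulli laws with parameter 0 or 1 are point masses, and so is their product.\<close>

lemma mv_bernoulli_design:
  fixes x :: "real ^ 'n"
  assumes "x \<in> designs"
  shows "mv_bernoulli x = return_pmf x"
proof -
  have x: "x $ i = 0 \<or> x $ i = 1" for i using assms by (auto simp: designs_def)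
  have "bernoulli_pmf (x $ i) = return_pmf (x $ i = 1)" for i
  proof (rule pmf_eqI)
    fix b
    show "pmf (bernoulli_pmf (x $ i)) b = pmf (return_pmf (x $ i = 1)) b"
      using x[of i] by (cases b) (auto simp: pmf_return)
  qed
  then have "mv_bernoulli x = return_pmf (\<chi> i. of_bool (x $ i = 1))"
    by (simp add: mv_bernoulli_def Pi_pmf_return_pmf)
  also have "(\<chi> i. of_bool (x $ i = 1)) = x"
    using x by (auto simp: vec_eq_iff of_bool_def)
  finally show ?thesis .
qed

lemma expectation_mv_bernoulli_in_hull:
  fixes J :: "real ^ 'n \<Rightarrow> real"
  shows "measure_pmf.expectation (mv_bernoulli \<theta>) J \<in> convex hull (J ` designs)"
proof -
  have "(\<Sum>\<zeta>\<in>designs. pmf (mv_bernoulli \<theta>) \<zeta> *\<^sub>R J \<zeta>) \<in> convex hull (J ` designs)"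
    using finite_designs convex_convex_hull
    by (rule convex_sum)
      (auto simp: sum_pmf_eq_1[OF finite_designs set_pmf_mv_bernoulli] intro!: hull_inc)
  then show ?thesis by (simp add: expectation_mv_bernoulli mult.commute)
qed

text \<open>
  The expectation is a finite sum over the designs, and on the cube each weight is a polynomial in
  the parameter. Off the cube the Bernoulli parameters are clipped and the polynomial formula no longer applies,
  so continuity is relative to the cube.
\<close>

lemma continuous_on_expectation_mv_bernoulli:
  fixes J :: "real ^ 'n \<Rightarrow> real"
  shows "continuous_on params (\<lambda>\<theta>. measure_pmf.expectation (mv_bernoulli \<theta>) J)"
proof -
  have "continuous_on params (\<lambda>\<theta> :: real ^ 'n. \<Sum>\<zeta>\<in>designs. J \<zeta> *
          (\<Prod>i\<in>UNIV. \<theta> $ i * \<zeta> $ i + (1 - \<theta> $ i) * (1 - \<zeta> $ i)))"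
    by (intro continuous_intros)
  then show ?thesis
    by (rule continuous_on_eq) (simp add: expectation_mv_bernoulli pmf_mv_bernoulli)
qed

lemma expectation_image_params:
  fixes J :: "real ^ 'n \<Rightarrow> real"
  shows "(\<lambda>\<theta>. measure_pmf.expectation (mv_bernoulli \<theta>) J) ` params = convex hull (J ` designs)"
    (is "?E ` params = _")
proof
  show "?E ` params \<subseteq> convex hull (J ` designs)"
    using expectation_mv_bernoulli_in_hull by blast
  \<comment> \<open>A connected set of reals is convex, so the image contains the hull as soon as it contains
    the values at the vertices.\<close>
  have "connected (?E ` params)"
    by (intro connected_continuous_image continuous_on_expectation_mv_bernoulli)
      (simp add: params_eq_convex_hull_designs convex_connected)
  then have "convex (?E ` params)"
    by (simp add: connected_convex_1)
  moreover have "J ` designs \<subseteq> ?E ` params"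
  proof
    fix c assume "c \<in> J ` designs"
    then obtain x where "x \<in> designs" "c = J x" by blast
    then have "x \<in> params" "c = ?E x"
      using designs_subset_params by (auto simp: mv_bernoulli_design)
    then show "c \<in> ?E ` params" by blast
  qed
  ultimately show "convex hull (J ` designs) \<subseteq> ?E ` params"
    by (intro hull_minimal)
qed

theorem proposition3p1:
  fixes \<Psi> \<Phi> J \<Upsilon> :: "real ^ 'n \<Rightarrow> real" and \<alpha> :: real and C :: "real set"
  assumes J: "\<And>\<zeta>. \<zeta> \<in> designs \<Longrightarrow> J \<zeta> = \<Psi> \<zeta> + \<alpha> * \<Phi> \<zeta>"
    and \<Upsilon>: "\<And>\<theta>. \<theta> \<in> params \<Longrightarrow> \<Upsilon> \<theta> = measure_pmf.expectation (mv_bernoulli \<theta>) J"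
    and C: "C = {c. \<exists>\<zeta>\<in>designs. c = J \<zeta>}"
  shows "((params :: (real ^ 'n) set) = convex hull designs) \<and>
         (convex hull C = {\<Upsilon> \<theta> |\<theta>. \<theta> \<in> params}) \<and>
         ({c. c extreme_point_of (convex hull C)} \<subseteq> C) \<and>
         ({c. c extreme_point_of (convex hull C)} = {Min C, Max C}) \<and>
         (\<forall>x\<in>designs. \<Upsilon> x = J x) \<and>
         (\<forall>\<theta>\<in>params. Min C \<le> \<Upsilon> \<theta> \<and> \<Upsilon> \<theta> \<le> Max C) \<and>
         (\<forall>\<zeta>opt \<theta>opt. is_arg_min J (\<lambda>\<zeta>. \<zeta> \<in> designs) \<zeta>opt \<longrightarrow>
           is_arg_min \<Upsilon> (\<lambda>\<theta>. \<theta> \<in> params) \<theta>opt \<longrightarrow>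
           \<Upsilon> \<theta>opt = Min C \<and> Min C = J \<zeta>opt)"
proof -
  have C_image: "C = J ` designs" using C by auto
  then have fin: "finite C" "C \<noteq> {}"
    by (simp_all add: finite_designs designs_nonempty)
  have image: "convex hull C = {\<Upsilon> \<theta> |\<theta>. \<theta> \<in> params}"
    unfolding C_image expectation_image_params[symmetric] Setcompr_eq_image
    using \<Upsilon> by (intro image_cong) simp_all
  have extreme: "{c. c extreme_point_of (convex hull C)} = {Min C, Max C}"
    using fin by (rule extreme_points_convex_hull_finite_real)
  have vertices: "\<Upsilon> x = J x" if "x \<in> designs" for x
    using that designs_subset_params by (auto simp: \<Upsilon> mv_bernoulli_design)
  have bounds: "Min C \<le> \<Upsilon> \<theta> \<and> \<Upsilon> \<theta> \<le> Max C" if "\<theta> \<in> params" for \<theta>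
  proof -
    have "\<Upsilon> \<theta> \<in> {Min C..Max C}"
      using that image convex_hull_finite_real[OF fin] by blast
    then show ?thesis by simp
  qed
  have minimizers: "\<Upsilon> \<theta>opt = Min C \<and> Min C = J \<zeta>opt"
    if z: "is_arg_min J (\<lambda>\<zeta>. \<zeta> \<in> designs) \<zeta>opt"
      and t: "is_arg_min \<Upsilon> (\<lambda>\<theta>. \<theta> \<in> params) \<theta>opt" for \<zeta>opt \<theta>opt
  proof -
    have z_in: "\<zeta>opt \<in> designs" and z_min: "\<And>\<zeta>. \<zeta> \<in> designs \<Longrightarrow> J \<zeta>opt \<le> J \<zeta>"
      using z by (auto simp: is_arg_min_linorder)
    have t_in: "\<theta>opt \<in> params" and t_min: "\<And>\<theta>. \<theta> \<in> params \<Longrightarrow> \<Upsilon> \<theta>opt \<le> \<Upsilon> \<theta>"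
      using t by (auto simp: is_arg_min_linorder)
    have Min: "Min C = J \<zeta>opt"
      using fin z_in z_min by (intro Min_eqI) (auto simp: C_image)
    have "\<Upsilon> \<theta>opt \<le> \<Upsilon> \<zeta>opt"
      using z_in designs_subset_params by (blast intro: t_min)
    then have "\<Upsilon> \<theta>opt \<le> Min C"
      using vertices[OF z_in] Min by simp
    then show ?thesis
      using bounds[OF t_in] Min by simp
  qed
  have "{c. c extreme_point_of (convex hull C)} \<subseteq> C"
    using extreme fin by simp
  then show ?thesis
    using params_eq_convex_hull_designs image extreme vertices bounds minimizers by blast
qed

end
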